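(* Let $G=(V,E)$ be an infinite, locally finite, connected graph without loops or multiple edges, and fix a vertex $x_0\in V$. Let $A$ be a finite subgraph of $G$ and let $c$ be a constant such that for all vertices $x\in G\setminus A$ $$\frac{m_{+1}(x)-m_{-1}(x)}{m(x)}\ge c>0 .$$ Then $\lambda_0(\Delta_{bd,G\setminus A})\ge \frac{c^2}{2}$. If, in addition, $m(x)\ge m$ for all $x\in G\setminus A$, where $m$ is a constant, then $$\lambda_0(\Delta_{G\setminus A})\ge\frac{mc^2}{2}.$$
   Context: $m(x)$ is the valence of $x$; $r(x)=d(x,x_0)$ is the graph distance to $x_0$; $m_{+1}(x)=|\{y\sim x: r(y)=r(x)+1\}|$ and $m_{-1}(x)=|\{y\sim x: r(y)=r(x)-1\}|$. $x\in G\setminus A$ means that $x$ is a vertex of $G$ not belonging to $A$. $\Delta f(x)=\sum_{y\sim x}(f(x)-f(y))$ is the Laplacian and $\Delta_{bd}f(x)=\frac{1}{m(x)}\Delta f(x)$ is the bounded (combinatorial) Laplacian. $\langle f,g\rangle=\sum_{x\in V}f(x)g(x)$ and $\langle f,g\rangle_{bd}=\sum_{x\in V}m(x)f(x)g(x)$; $\ell^2_{bd}(V)$ is the Hilbert space of $f:V\to\mathbf{R}$ with $\langle f,f\rangle_{bd}<\infty$. $\Delta_{bd,G\setminus A}$ (respectively $\Delta_{G\setminus A}$) denotes the reduced operator, acting on functions vanishing on $A$, which equals $\Delta_{bd}f$ (respectively $\Delta f$) at vertices outside $A$ and $0$ on $A$. The bottoms of the spectra are $$\lambda_0(\Delta_{bd,G\setminus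 A})=\inf_f\frac{\langle\Delta_{bd}f,f\rangle_{bd}}{\langle f,f\rangle_{bd}},\qquad \lambda_0(\Delta_{G\setminus A})=\inf_f\frac{\langle\Delta f,f\rangle}{\langle f,f\rangle},$$ where the first infimum is over non-zero $f\in\ell^2_{bd}(V)$ vanishing on $A$ and the second is over non-zero finitely supported $f:V\to\mathbf{R}$ vanishing on $A$. *)

theory Defs
  imports "HOL-Analysis.Infinite_Sum"
begin

record 'a graph =
  verts :: "'a set"
  edges :: "'a set set"

definition simple_graph :: "'a graph \<Rightarrow> bool" where
  "simple_graph G \<longleftrightarrow> (\<forall>e\<in>edges G. e \<subseteq> verts G \<and> card e = 2)"

definition subgraph :: "'a graph \<Rightarrow> 'a graph \<Rightarrow> bool" where
  "subgraph A G \<longleftrightarrow> simple_graph A \<and> verts A \<subseteq> verts G \<and> edges A \<subseteq> edges G"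

definition adj :: "'a graph \<Rightarrow> 'a \<Rightarrow> 'a \<Rightarrow> bool" where
  "adj G x y \<longleftrightarrow> {x, y} \<in> edges G"

definition nbrs :: "'a graph \<Rightarrow> 'a \<Rightarrow> 'a set" where
  "nbrs G x = {y. adj G x y}"

definition locally_finite :: "'a graph \<Rightarrow> bool" where
  "locally_finite G \<longleftrightarrow> (\<forall>x\<in>verts G. finite (nbrs G x))"

definition connected_graph :: "'a graph \<Rightarrow> bool" where
  "connected_graph G \<longleftrightarrow> (\<forall>x\<in>verts G. \<forall>y\<in>verts G. (adj G)\<^sup>*\<^sup>* x y)"

definition valence :: "'a graph \<Rightarrow> 'a \<Rightarrow> nat" where
  "valence G x = card (nbrs G x)"

text \<open>\<open>(adj G ^^ n) x y\<close> says that there is a walk of length \<open>n\<close> from \<open>x\<close> to \<open>y\<close>. The value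
  is meaningful only for \<open>x\<close>, \<open>y\<close> in the same component.\<close>

definition gdist :: "'a graph \<Rightarrow> 'a \<Rightarrow> 'a \<Rightarrow> nat" where
  "gdist G x y = (LEAST n. (adj G ^^ n) x y)"

definition m_plus :: "'a graph \<Rightarrow> 'a \<Rightarrow> 'a \<Rightarrow> nat" where
  "m_plus G x0 x = card {y \<in> nbrs G x. gdist G y x0 = gdist G x x0 + 1}"

text \<open>The condition \<open>r(y) = r(x) - 1\<close> is written without subtraction, which would truncate at
  \<open>x = x0\<close>.\<close>

definition m_minus :: "'a graph \<Rightarrow> 'a \<Rightarrow> 'a \<Rightarrow> nat" where
  "m_minus G x0 x = card {y \<in> nbrs G x. gdist G y x0 + 1 = gdist G x x0}"

text \<open>Real functions on the vertex set are represented by functions on the whole type; their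
  values outside \<open>verts G\<close> are never used.\<close>

definition laplacian :: "'a graph \<Rightarrow> ('a \<Rightarrow> real) \<Rightarrow> 'a \<Rightarrow> real" where
  "laplacian G f x = (\<Sum>y\<in>nbrs G x. f x - f y)"

definition laplacian_bd :: "'a graph \<Rightarrow> ('a \<Rightarrow> real) \<Rightarrow> 'a \<Rightarrow> real" where
  "laplacian_bd G f x = laplacian G f x / real (valence G x)"

definition ip :: "'a graph \<Rightarrow> ('a \<Rightarrow> real) \<Rightarrow> ('a \<Rightarrow> real) \<Rightarrow> real" where
  "ip G f g = (\<Sum>\<^sub>\<infinity>x\<in>verts G. f x * g x)"

definition ip_bd :: "'a graph \<Rightarrow> ('a \<Rightarrow> real) \<Rightarrow> ('a \<Rightarrow> real) \<Rightarrow> real" where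
  "ip_bd G f g = (\<Sum>\<^sub>\<infinity>x\<in>verts G. real (valence G x) * f x * g x)"

definition ell2_bd :: "'a graph \<Rightarrow> ('a \<Rightarrow> real) set" where
  "ell2_bd G = {f. (\<lambda>x. real (valence G x) * f x * f x) summable_on verts G}"

definition fin_supp :: "'a graph \<Rightarrow> ('a \<Rightarrow> real) set" where
  "fin_supp G = {f. finite {x \<in> verts G. f x \<noteq> 0}}"

definition nonzero_on_graph :: "'a graph \<Rightarrow> ('a \<Rightarrow> real) \<Rightarrow> bool" where
  "nonzero_on_graph G f \<longleftrightarrow> (\<exists>x\<in>verts G. f x \<noteq> 0)"

definition vanishes_on :: "'a graph \<Rightarrow> ('a \<Rightarrow> real) \<Rightarrow> bool" where
  "vanishes_on A f \<longleftrightarrow> (\<forall>x\<in>verts A. f x = 0)"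

text \<open>Bottoms of the spectra of the reduced Laplacians on \<open>G \ A\<close>. A reduced Laplacian differs
  from the unreduced one only on \<open>A\<close>, where the test functions vanish, so the Rayleigh quotients
  may be formed with either. For infinite \<open>G\<close> and finite \<open>A\<close> both infima are over non-empty sets
  of nonnegative reals, so the real-valued \<open>Inf\<close> is the genuine infimum.\<close>

definition lambda0_bd :: "'a graph \<Rightarrow> 'a graph \<Rightarrow> real" where
  "lambda0_bd G A =
     Inf {ip_bd G (laplacian_bd G f) f / ip_bd G f f | f.
            f \<in> ell2_bd G \<and> nonzero_on_graph G f \<and> vanishes_on A f}"

definition lambda0 :: "'a graph \<Rightarrow> 'a graph \<Rightarrow> real" where
  "lambda0 G A =
     Inf {ip G (laplacian G f) f / ip G f f | f.
            f \<in> fin_supp G \<and> nonzero_on_graph G f \<and> vanishes_on A f}"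

end

theory Submission
  imports Defs
begin

text \<open>
  Write \<open>M = \<Sum>\<^sub>x m(x) f(x)\<^sup>2\<close> for the weighted norm of \<open>f\<close> and \<open>E = \<langle>\<Delta>f, f\<rangle>\<close> for its energy, and let
  \<open>s(x, y) = r(y) - r(x)\<close> be the sign of an arc that leads to the next or the previous sphere
  around \<open>x0\<close> (and \<open>0\<close> for an arc within a sphere). Since \<open>m\<^sub>+\<^sub>1(x) - m\<^sub>-\<^sub>1(x)\<close> is the sum of \<open>s\<close> over
  the arcs that leave \<open>x\<close>, the hypothesis on the valences yields
  \<open>c M \<le> \<Sum>\<^sub>x (m\<^sub>+\<^sub>1(x) - m\<^sub>-\<^sub>1(x)) f(x)\<^sup>2 = \<Sum> s(x, y) f(x)\<^sup>2\<close>, a sum over all arcs; the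
  vertices of \<open>A\<close> contribute nothing, because \<open>f\<close> vanishes there.

  As \<open>s\<close> is antisymmetric, averaging each arc with its reversal turns the right-hand side into
  half the sum of \<open>s(x, y) (f(x)\<^sup>2 - f(y)\<^sup>2)\<close>, while \<open>E\<close> becomes half the sum of
  \<open>(f(x) - f(y))\<^sup>2\<close>. The difference of squares factors, and the weighted inequality between
  arithmetic and geometric means bounds it, arc by arc, by
  \<open>(f(x) - f(y))\<^sup>2 / c + (c / 2) (f(x)\<^sup>2 + f(y)\<^sup>2)\<close>. Summation gives \<open>c M \<le> E / c + (c / 2) M\<close>,
  that is \<open>E \<ge> (c\<^sup>2 / 2) M\<close> (\<open>energy_lower_bound\<close>).

  Both claims follow from this one inequality: \<open>E\<close> is also \<open>\<langle>\<Delta>\<^sub>b\<^sub>d f, f\<rangle>\<^sub>b\<^sub>d\<close>, the factors \<open>m(x)\<close>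
  cancelling, and \<open>M \<ge> m \<langle>f, f\<rangle>\<close> if the valences are at least \<open>m\<close> outside \<open>A\<close>.
\<close>

section \<open>Arcs and the radial sign\<close>

definition arcs :: "'a graph \<Rightarrow> ('a \<times> 'a) set" where
  "arcs G = Sigma (verts G) (nbrs G)"

definition radial_sign :: "'a graph \<Rightarrow> 'a \<Rightarrow> 'a \<Rightarrow> 'a \<Rightarrow> real" where
  "radial_sign G x0 x y =
     of_bool (gdist G y x0 = gdist G x x0 + 1) - of_bool (gdist G y x0 + 1 = gdist G x x0)"

lemma radial_sign_antisym: "radial_sign G x0 y x = - radial_sign G x0 x y"
  unfolding radial_sign_def by auto

lemma abs_radial_sign_le_1: "\<bar>radial_sign G x0 x y\<bar> \<le> 1"
  unfolding radial_sign_def by auto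

lemma sum_radial_sign:
  assumes "finite (nbrs G x)"
  shows "(\<Sum>y\<in>nbrs G x. radial_sign G x0 x y) = real (m_plus G x0 x) - real (m_minus G x0 x)"
  using assms
  by (simp add: radial_sign_def sum_subtractf m_plus_def m_minus_def of_bool_def
      sum.If_cases Int_def)

lemma swap_in_arcs:
  assumes "simple_graph G" and "p \<in> arcs G"
  shows "prod.swap p \<in> arcs G"
  using assms unfolding arcs_def simple_graph_def nbrs_def adj_def
  by (fastforce simp: insert_commute)

section \<open>Sums over arcs\<close>

lemma infsum_swap_arcs:
  fixes K :: "'a \<times> 'a \<Rightarrow> real"
  assumes "simple_graph G"
  shows "infsum (\<lambda>p. K (prod.swap p)) (arcs G) = infsum K (arcs G)"
  by (rule infsum_reindex_bij_witness[where i = prod.swap and j = prod.swap])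
    (auto simp: swap_in_arcs[OF assms])

lemma summable_swap_arcs:
  fixes K :: "'a \<times> 'a \<Rightarrow> real"
  assumes "simple_graph G"
  shows "(\<lambda>p. K (prod.swap p)) summable_on arcs G \<longleftrightarrow> K summable_on arcs G"
  by (rule summable_on_reindex_bij_witness[where i = prod.swap and j = prod.swap])
    (auto simp: swap_in_arcs[OF assms])

text \<open>Averaging over reversal of arcs: it suffices to check the sign of a summand on the two
  arcs of an edge together.\<close>

lemma infsum_arcs_nonneg:
  fixes K :: "'a \<times> 'a \<Rightarrow> real"
  assumes "simple_graph G" and "K summable_on arcs G"
    and "\<And>p. p \<in> arcs G \<Longrightarrow> K p + K (prod.swap p) \<ge> 0"
  shows "infsum K (arcs G) \<ge> 0"
proof -
  have "0 \<le> infsum (\<lambda>p. K p + K (prod.swap p)) (arcs G)"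
    using assms(3) by (rule infsum_nonneg)
  also have "\<dots> = 2 * infsum K (arcs G)"
    using assms by (simp add: infsum_add summable_swap_arcs infsum_swap_arcs)
  finally show ?thesis
    by simp
qed

lemma infsum_arcs:
  fixes K :: "'a \<times> 'a \<Rightarrow> real"
  assumes "locally_finite G" and "K summable_on arcs G"
  shows "infsum K (arcs G) = (\<Sum>\<^sub>\<infinity>x\<in>verts G. \<Sum>y\<in>nbrs G x. K (x, y))"
proof -
  have "infsum K (arcs G) = (\<Sum>\<^sub>\<infinity>x\<in>verts G. \<Sum>\<^sub>\<infinity>y\<in>nbrs G x. K (x, y))"
    using assms(2) unfolding arcs_def by (rule infsum_Sigma_banach[symmetric])
  also have "\<dots> = (\<Sum>\<^sub>\<infinity>x\<in>verts G. \<Sum>y\<in>nbrs G x. K (x, y))"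
    using assms(1) by (intro infsum_cong) (simp add: locally_finite_def)
  finally show ?thesis .
qed

lemma summable_arcs_source_square:
  assumes "locally_finite G" and "f \<in> ell2_bd G"
  shows "(\<lambda>(x, y). (f x)\<^sup>2) summable_on arcs G"
  unfolding arcs_def
proof (rule summable_on_SigmaI)
  show "((\<lambda>y. case (x, y) of (x, y) \<Rightarrow> (f x)\<^sup>2) has_sum real (valence G x) * f x * f x) (nbrs G x)"
    if "x \<in> verts G" for x
    using assms(1) that
    by (auto simp: locally_finite_def valence_def power2_eq_square intro!: has_sum_finiteI)
  show "(\<lambda>x. real (valence G x) * f x * f x) summable_on verts G"
    using assms(2) by (simp add: ell2_bd_def)
qed auto

text \<open>The arc sums below converge absolutely because their terms are bounded by squares of
  values at the two ends, and both ends contribute the same sum.\<close>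

lemma summable_arcs_dominated:
  fixes K :: "'a \<times> 'a \<Rightarrow> real"
  assumes "simple_graph G" and "locally_finite G" and "f \<in> ell2_bd G"
    and "\<And>x y. \<bar>K (x, y)\<bar> \<le> C * ((f x)\<^sup>2 + (f y)\<^sup>2)"
  shows "K summable_on arcs G"
proof -
  let ?P = "\<lambda>(x, y). (f x)\<^sup>2"
  have "?P summable_on arcs G"
    using assms(2,3) by (rule summable_arcs_source_square)
  then have "(\<lambda>p. C * (?P p + ?P (prod.swap p))) summable_on arcs G"
    using summable_swap_arcs[OF assms(1), of ?P]
    by (intro summable_on_cmult_right summable_on_add) auto
  then have "(\<lambda>p. norm (K p)) summable_on arcs G"
    by (rule abs_summable_on_comparison_test') (use assms(4) in auto)
  then show ?thesis
    by (rule abs_summable_summable)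
qed

section \<open>The energy bound\<close>

text \<open>The cancellation of valences also holds at isolated vertices, where the Laplacian is an
  empty sum.\<close>

lemma valence_laplacian_bd:
  assumes "finite (nbrs G x)"
  shows "real (valence G x) * laplacian_bd G f x = laplacian G f x"
  using assms by (auto simp: laplacian_bd_def laplacian_def valence_def)

lemma ip_bd_laplacian_bd:
  assumes "locally_finite G"
  shows "ip_bd G (laplacian_bd G f) f = ip G (laplacian G f) f"
  unfolding ip_bd_def ip_def
  using assms by (intro infsum_cong) (simp add: valence_laplacian_bd locally_finite_def)

text \<open>After multiplication by \<open>c\<close>, with \<open>u = a - b\<close> and \<open>v = a + b\<close>, the left-hand side is the sum
  of squares \<open>(u - c s v / 2)\<^sup>2 + c\<^sup>2 v\<^sup>2 (1 - s\<^sup>2) / 4 + c\<^sup>2 u\<^sup>2 / 4\<close>.\<close>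

lemma edge_inequality:
  fixes a b c s :: real
  assumes "c > 0" and "\<bar>s\<bar> \<le> 1"
  shows "(a - b)\<^sup>2 / c + c / 2 * (a\<^sup>2 + b\<^sup>2) - s * (a\<^sup>2 - b\<^sup>2) \<ge> 0"
proof -
  have "s\<^sup>2 \<le> 1"
    using assms(2) by (simp add: abs_square_le_1)
  have "c * ((a - b)\<^sup>2 / c + c / 2 * (a\<^sup>2 + b\<^sup>2) - s * (a\<^sup>2 - b\<^sup>2)) =
      (a - b)\<^sup>2 + c\<^sup>2 / 2 * (a\<^sup>2 + b\<^sup>2) - c * s * (a\<^sup>2 - b\<^sup>2)"
    using assms(1) by (simp add: field_simps power2_eq_square)
  also have "\<dots> = ((a - b) - c * s * (a + b) / 2)\<^sup>2 + (c * (a + b))\<^sup>2 * (1 - s\<^sup>2) / 4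
      + (c * (a - b))\<^sup>2 / 4"
    by (simp add: field_simps power2_eq_square)
  also have "\<dots> \<ge> 0"
    using \<open>s\<^sup>2 \<le> 1\<close> by simp
  finally show ?thesis
    using assms(1) by (simp add: zero_le_mult_iff)
qed

text \<open>The discrete analogue of integrating the divergence of a radial field against \<open>f\<^sup>2\<close>: the net
  outward valence acts as the divergence of the sign of the arcs.\<close>

lemma radial_divergence_bound:
  fixes c :: real
  assumes "simple_graph G" and "locally_finite G" and "f \<in> ell2_bd G" and "c > 0"
  shows "(\<lambda>x. (real (m_plus G x0 x) - real (m_minus G x0 x)) * (f x)\<^sup>2) summable_on verts G"
    and "(\<Sum>\<^sub>\<infinity>x\<in>verts G. (real (m_plus G x0 x) - real (m_minus G x0 x)) * (f x)\<^sup>2)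
           \<le> ip G (laplacian G f) f / c + c / 2 * ip_bd G f f"
proof -
  let ?s = "radial_sign G x0"
  define P :: "'a \<times> 'a \<Rightarrow> real" where "P = (\<lambda>(x, y). (f x)\<^sup>2)"
  define Q where "Q = (\<lambda>(x, y). f x * (f x - f y))"
  define R where "R = (\<lambda>(x, y). ?s x y * (f x)\<^sup>2)"
  have fin: "finite (nbrs G x)" if "x \<in> verts G" for x
    using assms(2) that by (simp add: locally_finite_def)
  have P: "P summable_on arcs G"
    using summable_arcs_source_square[OF assms(2,3)] by (simp add: P_def)
  have Q: "Q summable_on arcs G"
  proof (rule summable_arcs_dominated[OF assms(1-3)])
    fix x y
    have "\<bar>a * (a - b)\<bar> \<le> 2 * (a\<^sup>2 + b\<^sup>2)" for a b :: real
    proof -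
      have "2 * (a\<^sup>2 + b\<^sup>2) - a * (a - b) = ((a + b)\<^sup>2 + a\<^sup>2 + 3 * b\<^sup>2) / 2"
        and "2 * (a\<^sup>2 + b\<^sup>2) + a * (a - b) = ((a - b)\<^sup>2 + 5 * a\<^sup>2 + 3 * b\<^sup>2) / 2"
        by (simp_all add: power2_eq_square field_simps)
      moreover have "((a + b)\<^sup>2 + a\<^sup>2 + 3 * b\<^sup>2) / 2 \<ge> 0" "((a - b)\<^sup>2 + 5 * a\<^sup>2 + 3 * b\<^sup>2) / 2 \<ge> 0"
        by simp_all
      ultimately show ?thesis
        by linarith
    qed
    then show "\<bar>Q (x, y)\<bar> \<le> 2 * ((f x)\<^sup>2 + (f y)\<^sup>2)"
      by (simp add: Q_def)
  qed
  have R: "R summable_on arcs G"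
  proof (rule summable_arcs_dominated[OF assms(1-3)])
    fix x y
    have "\<bar>?s x y\<bar> * (f x)\<^sup>2 \<le> 1 * (f x)\<^sup>2"
      by (intro mult_right_mono abs_radial_sign_le_1) simp
    also have "\<dots> \<le> 1 * ((f x)\<^sup>2 + (f y)\<^sup>2)"
      by simp
    finally show "\<bar>R (x, y)\<bar> \<le> 1 * ((f x)\<^sup>2 + (f y)\<^sup>2)"
      by (simp add: R_def abs_mult)
  qed
  have row_R: "(\<Sum>y\<in>nbrs G x. R (x, y)) =
      (real (m_plus G x0 x) - real (m_minus G x0 x)) * (f x)\<^sup>2" if "x \<in> verts G" for x
    using fin[OF that] by (simp add: R_def sum_distrib_right[symmetric] sum_radial_sign)
  have "(\<lambda>x. \<Sum>\<^sub>\<infinity>y\<in>nbrs G x. R (x, y)) summable_on verts G"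
    using summable_on_Sigma_banach[of "\<lambda>x y. R (x, y)" "verts G" "nbrs G"] R
    by (simp add: arcs_def)
  then show "(\<lambda>x. (real (m_plus G x0 x) - real (m_minus G x0 x)) * (f x)\<^sup>2) summable_on verts G"
    by (rule summable_on_cong[THEN iffD1, rotated]) (simp add: fin row_R)
  have sum_P: "infsum P (arcs G) = ip_bd G f f"
    unfolding infsum_arcs[OF assms(2) P] ip_bd_def
    by (intro infsum_cong) (simp add: P_def valence_def power2_eq_square)
  have sum_Q: "infsum Q (arcs G) = ip G (laplacian G f) f"
    unfolding infsum_arcs[OF assms(2) Q] ip_def
    by (intro infsum_cong) (simp add: Q_def laplacian_def sum_distrib_left[symmetric] mult.commute)
  have sum_R: "infsum R (arcs G) =
      (\<Sum>\<^sub>\<infinity>x\<in>verts G. (real (m_plus G x0 x) - real (m_minus G x0 x)) * (f x)\<^sup>2)"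
    unfolding infsum_arcs[OF assms(2) R] by (intro infsum_cong) (rule row_R)
  let ?K = "\<lambda>p. 1 / c * Q p + c / 2 * P p - R p"
  have QP: "(\<lambda>p. 1 / c * Q p + c / 2 * P p) summable_on arcs G"
    by (intro summable_on_add summable_on_cmult_right P Q)
  have "0 \<le> infsum ?K (arcs G)"
  proof (rule infsum_arcs_nonneg[OF assms(1)])
    show "?K summable_on arcs G"
      using summable_on_add[OF QP, of "\<lambda>p. - R p"] R by (simp add: summable_on_uminus)
    fix p :: "'a \<times> 'a"
    obtain x y where p: "p = (x, y)"
      by (cases p)
    have "?K p + ?K (prod.swap p) =
        (f x - f y)\<^sup>2 / c + c / 2 * ((f x)\<^sup>2 + (f y)\<^sup>2) - ?s x y * ((f x)\<^sup>2 - (f y)\<^sup>2)"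
      using assms(4)
      by (simp add: p P_def Q_def R_def radial_sign_antisym[of G x0 y x])
        (simp add: field_simps power2_eq_square)
    also have "\<dots> \<ge> 0"
      using assms(4) abs_radial_sign_le_1 by (rule edge_inequality)
    finally show "0 \<le> ?K p + ?K (prod.swap p)" .
  qed
  also have "infsum ?K (arcs G) =
      1 / c * infsum Q (arcs G) + c / 2 * infsum P (arcs G) - infsum R (arcs G)"
    using infsum_add[OF QP, of "\<lambda>p. - R p"] R
      infsum_add[OF summable_on_cmult_right[OF Q, of "1 / c"] summable_on_cmult_right[OF P, of "c / 2"]]
    unfolding infsum_cmult_right[OF P] infsum_cmult_right[OF Q]
    by (simp only: summable_on_uminus infsum_uminus diff_conv_add_uminus)
  finally show "(\<Sum>\<^sub>\<infinity>x\<in>verts G. (real (m_plus G x0 x) - real (m_minus G x0 x)) * (f x)\<^sup>2)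
      \<le> ip G (laplacian G f) f / c + c / 2 * ip_bd G f f"
    by (simp add: sum_P sum_Q sum_R)
qed

lemma valence_pos:
  fixes c :: real
  assumes "c > 0"
    and "(real (m_plus G x0 x) - real (m_minus G x0 x)) / real (valence G x) \<ge> c"
  shows "valence G x > 0"
  using assms by (cases "valence G x = 0") auto

text \<open>Growth gives \<open>c M \<le> E / c + (c / 2) M\<close>, and the last term is absorbed on the left. With a
  weight \<open>t\<close> in place of \<open>c / 2\<close> the arcwise estimate would give \<open>E \<ge> 2 t (c - t) M\<close>, which is
  strongest at \<open>t = c / 2\<close>.\<close>

lemma energy_lower_bound:
  fixes c :: real
  assumes "simple_graph G" and "locally_finite G" and "f \<in> ell2_bd G" and "vanishes_on A f"
    and "c > 0"
    and growth: "\<And>x. x \<in> verts G - verts A \<Longrightarrow>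
           (real (m_plus G x0 x) - real (m_minus G x0 x)) / real (valence G x) \<ge> c"
  shows "ip G (laplacian G f) f \<ge> c\<^sup>2 / 2 * ip_bd G f f"
proof -
  let ?d = "\<lambda>x. real (m_plus G x0 x) - real (m_minus G x0 x)"
  have norm: "(\<lambda>x. real (valence G x) * f x * f x) summable_on verts G"
    using assms(3) by (simp add: ell2_bd_def)
  have "c * ip_bd G f f = (\<Sum>\<^sub>\<infinity>x\<in>verts G. c * (real (valence G x) * f x * f x))"
    unfolding ip_bd_def by (simp add: infsum_cmult_right norm)
  also have "\<dots> \<le> (\<Sum>\<^sub>\<infinity>x\<in>verts G. ?d x * (f x)\<^sup>2)"
  proof (rule infsum_mono)
    fix x assume x: "x \<in> verts G"
    show "c * (real (valence G x) * f x * f x) \<le> ?d x * (f x)\<^sup>2"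
    proof (cases "x \<in> verts A")
      case True
      then show ?thesis
        using assms(4) by (simp add: vanishes_on_def)
    next
      case False
      then have "c * real (valence G x) \<le> ?d x"
        using growth[of x] valence_pos[OF \<open>c > 0\<close> growth, of x] x by (simp add: field_simps)
      then have "c * real (valence G x) * (f x)\<^sup>2 \<le> ?d x * (f x)\<^sup>2"
        by (rule mult_right_mono) simp
      then show ?thesis
        by (simp add: power2_eq_square mult.assoc)
    qed
  qed (intro summable_on_cmult_right norm radial_divergence_bound(1)[OF assms(1-3,5)])+
  also have "\<dots> \<le> ip G (laplacian G f) f / c + c / 2 * ip_bd G f f"
    using assms(1-3,5) by (rule radial_divergence_bound(2))
  finally show ?thesis
    using \<open>c > 0\<close> by (simp add: field_simps power2_eq_square)
qed

section \<open>Bottoms of the spectra\<close>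

lemma fin_supp_subset_ell2_bd: "fin_supp G \<subseteq> ell2_bd G"
  unfolding fin_supp_def ell2_bd_def
  by (auto intro!: finite_nonzero_values_imp_summable_on elim: rev_finite_subset)

text \<open>For the denominators of both Rayleigh quotients: the weight is the valence in one and
  constantly \<open>1\<close> in the other.\<close>

lemma weighted_square_sum_pos:
  fixes w f :: "'a \<Rightarrow> real"
  assumes "(\<lambda>x. w x * f x * f x) summable_on V" and "\<And>x. x \<in> V \<Longrightarrow> w x \<ge> 0"
    and "x \<in> V" and "w x > 0" and "f x \<noteq> 0"
  shows "(\<Sum>\<^sub>\<infinity>x\<in>V. w x * f x * f x) > 0"
proof (rule ccontr)
  assume "\<not> ?thesis"
  then have "w x * f x * f x = 0"
    using assms(1-3)
    by (intro nonneg_infsum_le_0D[of "\<lambda>x. w x * f x * f x" V]) (auto simp: mult.assoc)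
  then show False
    using assms(4,5) by simp
qed

theorem theorem4p3:
  fixes G A :: "'a graph" and x0 :: 'a and c :: real
  assumes "simple_graph G" and "infinite (verts G)" and "locally_finite G"
    and "connected_graph G" and "x0 \<in> verts G"
    and "subgraph A G" and "finite (verts A)"
    and "c > 0"
    and "\<And>x. x \<in> verts G - verts A \<Longrightarrow>
           (real (m_plus G x0 x) - real (m_minus G x0 x)) / real (valence G x) \<ge> c"
  shows "lambda0_bd G A \<ge> c\<^sup>2 / 2 \<and>
         (\<forall>m :: real. (\<forall>x \<in> verts G - verts A. real (valence G x) \<ge> m) \<longrightarrow>
            lambda0 G A \<ge> m * c\<^sup>2 / 2)"
proof -
  have bound: "ip G (laplacian G f) f \<ge> c\<^sup>2 / 2 * ip_bd G f f"
    if "f \<in> ell2_bd G" "vanishes_on A f" for f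
    using assms(1,3) that assms(8,9) by (rule energy_lower_bound)
  have support: "\<exists>x\<in>verts G. f x \<noteq> 0 \<and> valence G x > 0"
    if "nonzero_on_graph G f" "vanishes_on A f" for f
  proof -
    obtain x where "x \<in> verts G" "f x \<noteq> 0"
      using \<open>nonzero_on_graph G f\<close> by (auto simp: nonzero_on_graph_def)
    moreover from this have "x \<in> verts G - verts A"
      using \<open>vanishes_on A f\<close> by (auto simp: vanishes_on_def)
    then have "valence G x > 0"
      using valence_pos[OF assms(8,9)] by blast
    ultimately show ?thesis
      by blast
  qed
  \<comment> \<open>Both infima are over non-empty sets: a point mass outside the finite set \<open>A\<close> is a test
    function.\<close>
  obtain z where z: "z \<in> verts G - verts A"
    using infinite_imp_nonempty[OF Diff_infinite_finite[OF assms(7,2)]] by blast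
  define \<delta> :: "'a \<Rightarrow> real" where "\<delta> = (\<lambda>x. of_bool (x = z))"
  have "{x \<in> verts G. \<delta> x \<noteq> 0} \<subseteq> {z}"
    by (auto simp: \<delta>_def)
  then have \<delta>: "\<delta> \<in> fin_supp G" "nonzero_on_graph G \<delta>" "vanishes_on A \<delta>"
    using z by (auto simp: fin_supp_def nonzero_on_graph_def vanishes_on_def \<delta>_def
        intro: finite_subset)
  have "lambda0_bd G A \<ge> c\<^sup>2 / 2"
    unfolding lambda0_bd_def
  proof (rule cInf_greatest)
    show "{ip_bd G (laplacian_bd G f) f / ip_bd G f f | f.
        f \<in> ell2_bd G \<and> nonzero_on_graph G f \<and> vanishes_on A f} \<noteq> {}"
      using \<delta> fin_supp_subset_ell2_bd by blast
    fix q assume "q \<in> {ip_bd G (laplacian_bd G f) f / ip_bd G f f | f.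
        f \<in> ell2_bd G \<and> nonzero_on_graph G f \<and> vanishes_on A f}"
    then obtain f where f: "f \<in> ell2_bd G" "nonzero_on_graph G f" "vanishes_on A f"
      and q: "q = ip_bd G (laplacian_bd G f) f / ip_bd G f f"
      by blast
    have "ip_bd G f f > 0"
      using support[OF f(2,3)] f(1) unfolding ip_bd_def ell2_bd_def
      by (auto intro!: weighted_square_sum_pos)
    then show "c\<^sup>2 / 2 \<le> q"
      using bound[OF f(1,3)] by (simp add: q ip_bd_laplacian_bd[OF assms(3)] pos_le_divide_eq)
  qed
  moreover have "lambda0 G A \<ge> m * c\<^sup>2 / 2"
    if m: "\<forall>x \<in> verts G - verts A. real (valence G x) \<ge> m" for m :: real
    unfolding lambda0_def
  proof (rule cInf_greatest)
    show "{ip G (laplacian G f) f / ip G f f | f.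
        f \<in> fin_supp G \<and> nonzero_on_graph G f \<and> vanishes_on A f} \<noteq> {}"
      using \<delta> by blast
    fix q assume "q \<in> {ip G (laplacian G f) f / ip G f f | f.
        f \<in> fin_supp G \<and> nonzero_on_graph G f \<and> vanishes_on A f}"
    then obtain f where f: "f \<in> fin_supp G" "nonzero_on_graph G f" "vanishes_on A f"
      and q: "q = ip G (laplacian G f) f / ip G f f"
      by blast
    have f': "f \<in> ell2_bd G"
      using f(1) fin_supp_subset_ell2_bd by blast
    have sq: "(\<lambda>x. f x * f x) summable_on verts G"
      using f(1) by (auto simp: fin_supp_def intro!: finite_nonzero_values_imp_summable_on)
    have pos: "ip G f f > 0"
      using support[OF f(2,3)] sq weighted_square_sum_pos[of "\<lambda>_. 1" f "verts G"]
      by (auto simp: ip_def)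
    have "m * ip G f f = (\<Sum>\<^sub>\<infinity>x\<in>verts G. m * (f x * f x))"
      unfolding ip_def by (simp add: infsum_cmult_right sq)
    also have "\<dots> \<le> ip_bd G f f"
      unfolding ip_bd_def
    proof (rule infsum_mono)
      show "(\<lambda>x. m * (f x * f x)) summable_on verts G"
        using sq by (rule summable_on_cmult_right)
      show "(\<lambda>x. real (valence G x) * f x * f x) summable_on verts G"
        using f' by (simp add: ell2_bd_def)
      fix x assume x: "x \<in> verts G"
      show "m * (f x * f x) \<le> real (valence G x) * f x * f x"
      proof (cases "x \<in> verts A")
        case True
        then show ?thesis
          using f(3) by (simp add: vanishes_on_def)
      next
        case False
        then have "m * (f x * f x) \<le> real (valence G x) * (f x * f x)"
          using m x by (intro mult_right_mono) auto
        then show ?thesis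
          by (simp add: mult.assoc)
      qed
    qed
    finally have "c\<^sup>2 / 2 * (m * ip G f f) \<le> c\<^sup>2 / 2 * ip_bd G f f"
      by (rule mult_left_mono) simp
    also have "\<dots> \<le> ip G (laplacian G f) f"
      using f' f(3) by (rule bound)
    finally show "m * c\<^sup>2 / 2 \<le> q"
      using pos by (simp add: q pos_le_divide_eq mult_ac)
  qed
  ultimately show ?thesis
    by blast
qed

end
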